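(* Let $(X,T)$ be a topological flow with induced flow $(E(X),T)$ on its enveloping semigroup. If $(X,T)$ is uniformly rigid, then $(E(X),T)$ is uniformly rigid. Further, if $(X,T)$ is point transitive, the converse also holds: if $(E(X),T)$ is uniformly rigid, then $(X,T)$ is uniformly rigid.
   Context: A (topological) flow $(X,T)$ consists of a compact Hausdorff space $X$, a topological group $T$, and a continuous map $\pi:T\times X\to X$, written $\pi(t,x)=tx$, with $(st)x=s(tx)$ and such that each $\pi^t:X\to X$, $\pi^t(x)=tx$, is a homeomorphism (so the identity of $T$ acts as the identity map). Standing assumption: the space $X$ of the given flow has no isolated points (this is not required of $E(X)$). The enveloping semigroup is $E(X)=\overline{\{\pi^t: t\in T\}}\subseteq X^X$, the closure being taken in the product topology; $T$ acts on the compact Hausdorff space $E(X)$ by $t\cdot p=\pi^t\circ p$, giving the induced flow $(E(X),T)$. For any compact Hausdorff space $Y$ with a continuous action of $T$, let $\mathcal{U}_Y$ be the unique uniformity compatible with the topology of $Y$. $(Y,T)$ is uniformly rigid if there exists a net $(t_\alpha)$ in $T$ such that $(t_\alpha)$ converges uniformly to $e$, i.e. the maps $y\mapsto t_\alpha y$ converge uniformly on $Y$ to the identity map: for every $U\in\mathcal{U}_Y$, eventually $(t_\alpha y,y)\in U$ for all $y\in Y$. $(Y,T)$ is point transitive if some $x\in Y$ has dense orbit $Tx=\{tx:t\in T\}$. *)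

theory Defs
  imports "HOL-Analysis.Analysis"
begin

section \<open>Flows\<close>

text \<open>
  The acting group is a type of class \<^class>\<open>topological_group_add\<close>. That class does not
  assume commutativity (nor any separation axiom); the product $st$ and the identity $e$ of the
  usual multiplicative notation appear as \<open>s + t\<close> and \<open>0\<close>.
  Phase spaces are abstract topologies, so that a space and its enveloping semigroup, which is
  not a type, are treated alike. Values of an action outside \<open>topspace Y\<close> are irrelevant.
\<close>

definition flow :: "'y topology \<Rightarrow> ('g::topological_group_add \<Rightarrow> 'y \<Rightarrow> 'y) \<Rightarrow> bool" where
  "flow Y act \<longleftrightarrow>
     compact_space Y \<and> Hausdorff_space Y \<and>
     continuous_map (prod_topology euclidean Y) Y (\<lambda>(t, y). act t y) \<and>
     (\<forall>s t. \<forall>y\<in>topspace Y. act (s + t) y = act s (act t y)) \<and>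
     (\<forall>t. homeomorphic_map Y Y (act t))"

definition no_isolated_points :: "'y topology \<Rightarrow> bool" where
  "no_isolated_points Y \<longleftrightarrow> (\<forall>y\<in>topspace Y. \<not> openin Y {y})"

definition point_transitive :: "'y topology \<Rightarrow> ('g \<Rightarrow> 'y \<Rightarrow> 'y) \<Rightarrow> bool" where
  "point_transitive Y act \<longleftrightarrow>
     (\<exists>y\<in>topspace Y. Y closure_of (range (\<lambda>t. act t y)) = topspace Y)"

section \<open>The enveloping semigroup\<close>

text \<open>
  \<open>X\<^sup>X\<close> is the product topology over the index set \<open>topspace X\<close>; its points are the extensional
  functions, hence the restrictions below.
\<close>

definition self_maps :: "'a topology \<Rightarrow> ('a \<Rightarrow> 'a) topology" where
  "self_maps X = product_topology (\<lambda>_. X) (topspace X)"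

definition enveloping_semigroup ::
    "'a topology \<Rightarrow> ('g \<Rightarrow> 'a \<Rightarrow> 'a) \<Rightarrow> ('a \<Rightarrow> 'a) topology" where
  "enveloping_semigroup X act =
     subtopology (self_maps X)
       (self_maps X closure_of (range (\<lambda>t. restrict (act t) (topspace X))))"

definition enveloping_action ::
    "'a topology \<Rightarrow> ('g \<Rightarrow> 'a \<Rightarrow> 'a) \<Rightarrow> 'g \<Rightarrow> ('a \<Rightarrow> 'a) \<Rightarrow> ('a \<Rightarrow> 'a)" where
  "enveloping_action X act t p = compose (topspace X) (act t) p"

section \<open>The uniformity of a compact Hausdorff space\<close>

definition uniformity_on :: "'y set \<Rightarrow> ('y \<times> 'y) set set \<Rightarrow> bool" where
  "uniformity_on S \<U> \<longleftrightarrow>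
     S \<times> S \<in> \<U> \<and>
     (\<forall>U\<in>\<U>. Id_on S \<subseteq> U \<and> U \<subseteq> S \<times> S) \<and>
     (\<forall>U\<in>\<U>. \<forall>V. U \<subseteq> V \<and> V \<subseteq> S \<times> S \<longrightarrow> V \<in> \<U>) \<and>
     (\<forall>U\<in>\<U>. \<forall>V\<in>\<U>. U \<inter> V \<in> \<U>) \<and>
     (\<forall>U\<in>\<U>. U\<inverse> \<in> \<U>) \<and>
     (\<forall>U\<in>\<U>. \<exists>V\<in>\<U>. V O V \<subseteq> U)"

definition compatible_uniformity :: "'y topology \<Rightarrow> ('y \<times> 'y) set set \<Rightarrow> bool" where
  "compatible_uniformity Y \<U> \<longleftrightarrow>
     uniformity_on (topspace Y) \<U> \<and>
     (\<forall>S. openin Y S \<longleftrightarrow> S \<subseteq> topspace Y \<and> (\<forall>y\<in>S. \<exists>U\<in>\<U>. U `` {y} \<subseteq> S))"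

text \<open>
  Meaningful for compact Hausdorff \<open>Y\<close>, where exactly one compatible uniformity exists; see
  \<open>ex1_compatible_uniformity\<close> below.
\<close>

definition uniformity_of :: "'y topology \<Rightarrow> ('y \<times> 'y) set set" where
  "uniformity_of Y = (THE \<U>. compatible_uniformity Y \<U>)"

section \<open>Uniform rigidity\<close>

definition directed_set :: "'i set \<Rightarrow> ('i \<Rightarrow> 'i \<Rightarrow> bool) \<Rightarrow> bool" where
  "directed_set D le \<longleftrightarrow>
     D \<noteq> {} \<and>
     (\<forall>i\<in>D. le i i) \<and>
     (\<forall>i\<in>D. \<forall>j\<in>D. \<forall>k\<in>D. le i j \<longrightarrow> le j k \<longrightarrow> le i k) \<and>
     (\<forall>i\<in>D. \<forall>j\<in>D. \<exists>k\<in>D. le i k \<and> le j k)"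

definition converges_uniformly_to_id ::
    "'y topology \<Rightarrow> ('g \<Rightarrow> 'y \<Rightarrow> 'y) \<Rightarrow> 'i set \<Rightarrow> ('i \<Rightarrow> 'i \<Rightarrow> bool) \<Rightarrow> ('i \<Rightarrow> 'g) \<Rightarrow> bool" where
  "converges_uniformly_to_id Y act D le t \<longleftrightarrow>
     (\<forall>U\<in>uniformity_of Y. \<exists>i\<in>D. \<forall>j\<in>D. le i j \<longrightarrow> (\<forall>y\<in>topspace Y. (act (t j) y, y) \<in> U))"

text \<open>
  HOL cannot quantify over the type of the index set inside a definition, so the index sets are
  taken in the type \<open>'g set\<close>. By \<open>uniformly_rigidI\<close> below, a net over any other index
  type serves equally well as a witness.

  As usually stated, the definition puts no restriction on the net; in particular a constant net
  at the identity is not excluded.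
\<close>

definition uniformly_rigid :: "'y topology \<Rightarrow> ('g \<Rightarrow> 'y \<Rightarrow> 'y) \<Rightarrow> bool" where
  "uniformly_rigid Y act \<longleftrightarrow>
     (\<exists>(D :: 'g set set) le t. directed_set D le \<and> converges_uniformly_to_id Y act D le t)"

section \<open>Well-definedness\<close>

lemma uniformly_rigidI:
  fixes D :: "'i set" and t :: "'i \<Rightarrow> 'g"
  assumes dir: "directed_set D le" and conv: "converges_uniformly_to_id Y act D le t"
  shows "uniformly_rigid Y act"
proof -
  define tail where "tail i = t ` {j \<in> D. le i j}" for i
  define pick :: "'g set \<Rightarrow> 'g" where "pick A = (SOME g. g \<in> A)" for A
  have refl: "le i i" if "i \<in> D" for i using dir that by (auto simp: directed_set_def)
  have tail_mono: "tail k \<subseteq> tail i" if "i \<in> D" "k \<in> D" "le i k" for i k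
    using dir that unfolding directed_set_def tail_def by blast
  have pick: "pick (tail i) \<in> tail i" if "i \<in> D" for i
    unfolding pick_def by (rule someI[of _ "t i"]) (use that refl in \<open>auto simp: tail_def\<close>)
  have "directed_set (tail ` D) (\<lambda>A B. B \<subseteq> A)"
    unfolding directed_set_def
  proof (intro conjI ballI impI)
    show "tail ` D \<noteq> {}" using dir by (auto simp: directed_set_def)
    fix A B assume A: "A \<in> tail ` D" and B: "B \<in> tail ` D"
    from A obtain i where i: "i \<in> D" "A = tail i" by (rule imageE)
    from B obtain j where j: "j \<in> D" "B = tail j" by (rule imageE)
    obtain k where "k \<in> D" "le i k" "le j k" using dir i j unfolding directed_set_def by blast
    then show "\<exists>C\<in>tail ` D. C \<subseteq> A \<and> C \<subseteq> B" using i j tail_mono by blast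
  qed blast+
  moreover have "converges_uniformly_to_id Y act (tail ` D) (\<lambda>A B. B \<subseteq> A) pick"
    unfolding converges_uniformly_to_id_def
  proof
    fix U assume "U \<in> uniformity_of Y"
    then obtain i where i: "i \<in> D" and
      U: "\<And>j y. j \<in> D \<Longrightarrow> le i j \<Longrightarrow> y \<in> topspace Y \<Longrightarrow> (act (t j) y, y) \<in> U"
      using conv unfolding converges_uniformly_to_id_def by blast
    have "(act (pick A) y, y) \<in> U" if "A \<in> tail ` D" "A \<subseteq> tail i" "y \<in> topspace Y" for A y
    proof -
      have "pick A \<in> tail i" using that pick by blast
      then show ?thesis using U that by (auto simp: tail_def)
    qed
    then show "\<exists>A\<in>tail ` D. \<forall>B\<in>tail ` D. B \<subseteq> A \<longrightarrow>
        (\<forall>y\<in>topspace Y. (act (pick B) y, y) \<in> U)"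
      using i by blast
  qed
  ultimately show ?thesis unfolding uniformly_rigid_def by blast
qed

definition diagonal_neighbourhoods :: "'y topology \<Rightarrow> ('y \<times> 'y) set set" where
  "diagonal_neighbourhoods Y =
     {U. U \<subseteq> topspace Y \<times> topspace Y \<and>
         (\<forall>y\<in>topspace Y. \<exists>N. openin Y N \<and> y \<in> N \<and> N \<times> N \<subseteq> U)}"

lemma compact_space_point_cover:
  assumes "compact_space Y" and "\<And>y. y \<in> topspace Y \<Longrightarrow> openin Y (N y) \<and> y \<in> N y"
  obtains F where "finite F" "F \<subseteq> topspace Y" "topspace Y \<subseteq> (\<Union>y\<in>F. N y)"
proof -
  have "\<forall>S\<in>N ` topspace Y. openin Y S" "topspace Y \<subseteq> \<Union>(N ` topspace Y)" using assms(2) by auto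
  then obtain \<F> where "finite \<F>" "\<F> \<subseteq> N ` topspace Y" "topspace Y \<subseteq> \<Union>\<F>"
    using assms(1) unfolding compact_space_alt by meson
  moreover then obtain F where "F \<subseteq> topspace Y" "finite F" "\<F> = N ` F"
    by (meson finite_subset_image)
  ultimately show ?thesis using that by blast
qed

lemma diagonal_neighbourhoods_half:
  assumes "compact_space Y" "Hausdorff_space Y" "U \<in> diagonal_neighbourhoods Y"
  shows "\<exists>V\<in>diagonal_neighbourhoods Y. V O V \<subseteq> U"
proof -
  define T where "T = topspace Y"
  have reg: "regular_space Y" using assms compact_Hausdorff_imp_regular_space by blast
  have "\<exists>A B C. openin Y A \<and> A \<times> A \<subseteq> U \<and> openin Y B \<and> closedin Y C \<and> y \<in> B \<and> B \<subseteq> C \<and> C \<subseteq> A"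
    if y: "y \<in> T" for y
  proof -
    obtain A where A: "openin Y A" "y \<in> A" "A \<times> A \<subseteq> U"
      using assms(3) y unfolding diagonal_neighbourhoods_def T_def by blast
    obtain B C where "openin Y B" "closedin Y C" "y \<in> B" "B \<subseteq> C" "C \<subseteq> A"
      using reg A unfolding neighbourhood_base_of_closedin[symmetric] neighbourhood_base_of
      by meson
    then show ?thesis using A by blast
  qed
  then obtain A B C where ABC: "\<And>y. y \<in> T \<Longrightarrow> openin Y (A y) \<and> A y \<times> A y \<subseteq> U \<and> openin Y (B y) \<and>
      closedin Y (C y) \<and> y \<in> B y \<and> B y \<subseteq> C y \<and> C y \<subseteq> A y"
    by metis
  obtain F where F: "finite F" "F \<subseteq> T" "T \<subseteq> (\<Union>y\<in>F. B y)"
    using compact_space_point_cover[of Y B] assms(1) ABC unfolding T_def by blast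
  define V where "V = {(a, b) \<in> T \<times> T. \<forall>y\<in>F. a \<in> A y \<and> b \<in> A y \<or> a \<notin> C y \<and> b \<notin> C y}"
  have "V \<in> diagonal_neighbourhoods Y"
    unfolding diagonal_neighbourhoods_def mem_Collect_eq
  proof (intro conjI ballI)
    show "V \<subseteq> topspace Y \<times> topspace Y" by (auto simp: V_def T_def)
    fix z assume z: "z \<in> topspace Y"
    define M where "M y = (if z \<in> A y then A y else T - C y)" for y
    have "openin Y (M y)" if "y \<in> F" for y
      using ABC that F(2) unfolding M_def T_def by auto
    then have "openin Y (topspace Y \<inter> (\<Inter>y\<in>F. M y))"
      using F(1) by (cases "F = {}") auto
    moreover have "z \<in> topspace Y \<inter> (\<Inter>y\<in>F. M y)"
      using z ABC F(2) by (auto simp: M_def T_def)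
    moreover have "(topspace Y \<inter> (\<Inter>y\<in>F. M y)) \<times> (topspace Y \<inter> (\<Inter>y\<in>F. M y)) \<subseteq> V"
    proof clarify
      fix a b assume a: "a \<in> topspace Y" "a \<in> (\<Inter>y\<in>F. M y)"
        and b: "b \<in> topspace Y" "b \<in> (\<Inter>y\<in>F. M y)"
      have "a \<in> A y \<and> b \<in> A y \<or> a \<notin> C y \<and> b \<notin> C y" if "y \<in> F" for y
      proof -
        have "a \<in> M y" "b \<in> M y" using a b that by blast+
        then show ?thesis by (cases "z \<in> A y") (simp_all add: M_def)
      qed
      then show "(a, b) \<in> V" using a b by (simp add: V_def T_def)
    qed
    ultimately show "\<exists>N. openin Y N \<and> z \<in> N \<and> N \<times> N \<subseteq> V" by blast
  qed
  moreover have "V O V \<subseteq> U"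
  proof clarify
    fix a b c assume ab: "(a, b) \<in> V" and bc: "(b, c) \<in> V"
    then have "b \<in> T" by (auto simp: V_def)
    then obtain y where y: "y \<in> F" "b \<in> B y" using F by blast
    then have "b \<in> C y" "A y \<times> A y \<subseteq> U" using ABC F by blast+
    then show "(a, c) \<in> U" using ab bc y by (auto simp: V_def)
  qed
  ultimately show ?thesis by blast
qed

lemma compatible_diagonal_neighbourhoods:
  assumes "compact_space Y" "Hausdorff_space Y"
  shows "compatible_uniformity Y (diagonal_neighbourhoods Y)"
proof -
  have "uniformity_on (topspace Y) (diagonal_neighbourhoods Y)"
    unfolding uniformity_on_def
  proof (intro conjI ballI allI impI)
    show "topspace Y \<times> topspace Y \<in> diagonal_neighbourhoods Y"
      unfolding diagonal_neighbourhoods_def by blast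
  next
    fix U assume U: "U \<in> diagonal_neighbourhoods Y"
    show "Id_on (topspace Y) \<subseteq> U" "U \<subseteq> topspace Y \<times> topspace Y"
      using U unfolding diagonal_neighbourhoods_def by blast+
    show "\<exists>V\<in>diagonal_neighbourhoods Y. V O V \<subseteq> U"
      using diagonal_neighbourhoods_half assms U by blast
    have "N \<times> N \<subseteq> U\<inverse>" if "N \<times> N \<subseteq> U" for N using that by blast
    then show "U\<inverse> \<in> diagonal_neighbourhoods Y"
      using U unfolding diagonal_neighbourhoods_def by fast
  next
    fix U V assume "U \<in> diagonal_neighbourhoods Y" "U \<subseteq> V \<and> V \<subseteq> topspace Y \<times> topspace Y"
    then show "V \<in> diagonal_neighbourhoods Y"
      unfolding diagonal_neighbourhoods_def mem_Collect_eq by (meson order_trans)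
  next
    fix U V assume U: "U \<in> diagonal_neighbourhoods Y" and V: "V \<in> diagonal_neighbourhoods Y"
    have "\<exists>N. openin Y N \<and> y \<in> N \<and> N \<times> N \<subseteq> U \<inter> V" if "y \<in> topspace Y" for y
    proof -
      obtain N M where "openin Y N" "y \<in> N" "N \<times> N \<subseteq> U" "openin Y M" "y \<in> M" "M \<times> M \<subseteq> V"
        using U V \<open>y \<in> topspace Y\<close> unfolding diagonal_neighbourhoods_def by blast
      then have "openin Y (N \<inter> M) \<and> y \<in> N \<inter> M \<and> (N \<inter> M) \<times> (N \<inter> M) \<subseteq> U \<inter> V" by blast
      then show ?thesis by blast
    qed
    then show "U \<inter> V \<in> diagonal_neighbourhoods Y"
      using U unfolding diagonal_neighbourhoods_def by blast
  qed
  moreover have "openin Y S \<longleftrightarrow>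
      S \<subseteq> topspace Y \<and> (\<forall>y\<in>S. \<exists>U\<in>diagonal_neighbourhoods Y. U `` {y} \<subseteq> S)" for S
  proof (intro iffI conjI ballI)
    assume S: "openin Y S"
    then show "S \<subseteq> topspace Y" by (rule openin_subset)
    fix y assume y: "y \<in> S"
    define U where "U = S \<times> S \<union> (topspace Y - {y}) \<times> (topspace Y - {y})"
    have o: "openin Y (topspace Y - {y})"
      using closedin_t1_singleton[OF Hausdorff_imp_t1_space[OF assms(2)]] openin_subset[OF S] y
      by blast
    have "\<exists>N. openin Y N \<and> z \<in> N \<and> N \<times> N \<subseteq> U" if "z \<in> topspace Y" for z
    proof (cases "z = y")
      case True then show ?thesis using S y by (auto simp: U_def)
    next
      case False
      have "(topspace Y - {y}) \<times> (topspace Y - {y}) \<subseteq> U" unfolding U_def by blast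
      then show ?thesis using o False that by blast
    qed
    moreover have "U \<subseteq> topspace Y \<times> topspace Y"
      using openin_subset[OF S] by (auto simp: U_def)
    ultimately have "U \<in> diagonal_neighbourhoods Y"
      unfolding diagonal_neighbourhoods_def by blast
    moreover have "U `` {y} \<subseteq> S" by (auto simp: U_def)
    ultimately show "\<exists>U\<in>diagonal_neighbourhoods Y. U `` {y} \<subseteq> S" by blast
  next
    assume S: "S \<subseteq> topspace Y \<and> (\<forall>y\<in>S. \<exists>U\<in>diagonal_neighbourhoods Y. U `` {y} \<subseteq> S)"
    have "\<exists>N. openin Y N \<and> y \<in> N \<and> N \<subseteq> S" if "y \<in> S" for y
    proof -
      have y: "y \<in> topspace Y" using S that by blast
      obtain U where U: "U \<in> diagonal_neighbourhoods Y" "U `` {y} \<subseteq> S" using S \<open>y \<in> S\<close> by meson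
      obtain N where N: "openin Y N" "y \<in> N" "N \<times> N \<subseteq> U"
        using U(1) y unfolding diagonal_neighbourhoods_def by blast
      have "N \<subseteq> S" using N U(2) by blast
      then show ?thesis using N by blast
    qed
    then show "openin Y S" by (subst openin_subopen) blast
  qed
  ultimately show ?thesis unfolding compatible_uniformity_def by blast
qed

lemma compatible_uniformity_neighbourhood:
  assumes comp: "compatible_uniformity Y \<U>" and U: "U \<in> \<U>" and y: "y \<in> topspace Y"
  shows "\<exists>N. openin Y N \<and> y \<in> N \<and> N \<subseteq> U `` {y}"
proof -
  have uni: "uniformity_on (topspace Y) \<U>" using comp by (simp add: compatible_uniformity_def)
  define N where "N = {z \<in> topspace Y. \<exists>V\<in>\<U>. V `` {z} \<subseteq> U `` {y}}"
  have "\<exists>V\<in>\<U>. V `` {z} \<subseteq> N" if "z \<in> N" for z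
  proof -
    obtain V where V: "V \<in> \<U>" "V `` {z} \<subseteq> U `` {y}" using \<open>z \<in> N\<close> by (auto simp: N_def)
    obtain W where W: "W \<in> \<U>" "W O W \<subseteq> V" using uni V unfolding uniformity_on_def by meson
    have "W \<subseteq> topspace Y \<times> topspace Y" using uni W unfolding uniformity_on_def by meson
    then have "W `` {z} \<subseteq> N" using W V unfolding N_def by blast
    then show ?thesis using W by blast
  qed
  then have "openin Y N" using comp unfolding compatible_uniformity_def N_def by blast
  moreover have "y \<in> N" using y U by (auto simp: N_def)
  moreover have "N \<subseteq> U `` {y}"
  proof
    fix z assume "z \<in> N"
    then obtain V where V: "z \<in> topspace Y" "V \<in> \<U>" "V `` {z} \<subseteq> U `` {y}"
      by (auto simp: N_def)
    then have "Id_on (topspace Y) \<subseteq> V" using uni unfolding uniformity_on_def by meson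
    then show "z \<in> U `` {y}" using V by blast
  qed
  ultimately show ?thesis by blast
qed

lemma compatible_uniformity_unique:
  assumes cpt: "compact_space Y" and comp: "compatible_uniformity Y \<U>"
  shows "\<U> = diagonal_neighbourhoods Y"
proof (rule equalityI; rule subsetI)
  have uni: "uniformity_on (topspace Y) \<U>" using comp by (simp add: compatible_uniformity_def)
  have half: "\<exists>V\<in>\<U>. V O V \<subseteq> U" if "U \<in> \<U>" for U
    using uni that unfolding uniformity_on_def by meson
  have inv: "U\<inverse> \<in> \<U>" if "U \<in> \<U>" for U using uni that unfolding uniformity_on_def by meson
  have int: "U \<inter> V \<in> \<U>" if "U \<in> \<U>" "V \<in> \<U>" for U V
    using uni that unfolding uniformity_on_def by meson
  have sub: "U \<subseteq> topspace Y \<times> topspace Y" and diag: "Id_on (topspace Y) \<subseteq> U" if "U \<in> \<U>" for U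
    using uni that unfolding uniformity_on_def by meson+
  {
    fix U assume U: "U \<in> \<U>"
    obtain V where V: "V \<in> \<U>" "V O V \<subseteq> U" using half U by blast
    have W: "V \<inter> V\<inverse> \<in> \<U>" using V inv int by blast
    have "\<exists>N. openin Y N \<and> y \<in> N \<and> N \<times> N \<subseteq> U" if "y \<in> topspace Y" for y
    proof -
      obtain N where "openin Y N" "y \<in> N" "N \<subseteq> (V \<inter> V\<inverse>) `` {y}"
        using compatible_uniformity_neighbourhood[OF comp W \<open>y \<in> topspace Y\<close>] by blast
      moreover then have "N \<times> N \<subseteq> U" using V(2) by blast
      ultimately show ?thesis by blast
    qed
    then show "U \<in> diagonal_neighbourhoods Y"
      using sub[OF U] unfolding diagonal_neighbourhoods_def by blast
  next
    fix W assume W: "W \<in> diagonal_neighbourhoods Y"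
    have "\<exists>V N A. V \<in> \<U> \<and> A \<times> A \<subseteq> W \<and> (V O V) `` {y} \<subseteq> A \<and> openin Y N \<and> y \<in> N \<and> N \<subseteq> V `` {y}"
      if "y \<in> topspace Y" for y
    proof -
      obtain A where A: "openin Y A" "y \<in> A" "A \<times> A \<subseteq> W"
        using W \<open>y \<in> topspace Y\<close> unfolding diagonal_neighbourhoods_def by blast
      then obtain U where U: "U \<in> \<U>" "U `` {y} \<subseteq> A"
        using comp unfolding compatible_uniformity_def by blast
      obtain V where V: "V \<in> \<U>" "V O V \<subseteq> U" using half U by blast
      obtain N where "openin Y N" "y \<in> N" "N \<subseteq> V `` {y}"
        using compatible_uniformity_neighbourhood[OF comp V(1) \<open>y \<in> topspace Y\<close>] by blast
      moreover have "(V O V) `` {y} \<subseteq> A" using U V by blast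
      ultimately show ?thesis using A V by blast
    qed
    then obtain V N A where VNA: "\<And>y. y \<in> topspace Y \<Longrightarrow> V y \<in> \<U> \<and> A y \<times> A y \<subseteq> W \<and>
        (V y O V y) `` {y} \<subseteq> A y \<and> openin Y (N y) \<and> y \<in> N y \<and> N y \<subseteq> V y `` {y}"
      by metis
    obtain F where F: "finite F" "F \<subseteq> topspace Y" "topspace Y \<subseteq> (\<Union>y\<in>F. N y)"
      using compact_space_point_cover[of Y N] cpt VNA by blast
    have "finite G \<Longrightarrow> G \<subseteq> topspace Y \<Longrightarrow> topspace Y \<times> topspace Y \<inter> (\<Inter>y\<in>G. V y) \<in> \<U>" for G
    proof (induction G rule: finite_induct)
      case empty then show ?case using uni by (simp add: uniformity_on_def)
    next
      case (insert y G)
      then have "V y \<inter> (topspace Y \<times> topspace Y \<inter> (\<Inter>y\<in>G. V y)) \<in> \<U>" using int VNA by simp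
      then show ?case by (simp add: Int_left_commute)
    qed
    then have "topspace Y \<times> topspace Y \<inter> (\<Inter>y\<in>F. V y) \<in> \<U>" using F by blast
    moreover have "topspace Y \<times> topspace Y \<inter> (\<Inter>y\<in>F. V y) \<subseteq> W"
    proof clarify
      fix a b assume ab: "a \<in> topspace Y" "b \<in> topspace Y" "(a, b) \<in> (\<Inter>y\<in>F. V y)"
      obtain y where y: "y \<in> F" "a \<in> N y" using ab F by blast
      then have yT: "y \<in> topspace Y" using F by blast
      have ya: "(y, a) \<in> V y" using VNA[OF yT] y by blast
      have "(a, a) \<in> V y" using diag VNA[OF yT] ab(1) by blast
      then have "a \<in> A y" "b \<in> A y" using VNA[OF yT] ya ab(3) y by blast+
      then show "(a, b) \<in> W" using VNA[OF yT] by blast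
    qed
    moreover have "W \<subseteq> topspace Y \<times> topspace Y"
      using W unfolding diagonal_neighbourhoods_def by blast
    ultimately show "W \<in> \<U>" using uni unfolding uniformity_on_def by meson
  }
qed

theorem ex1_compatible_uniformity:
  assumes "compact_space Y" "Hausdorff_space Y"
  shows "\<exists>!\<U>. compatible_uniformity Y \<U>"
  using compatible_diagonal_neighbourhoods[OF assms] compatible_uniformity_unique[OF assms(1)]
  by blast

lemma uniformity_of_eq:
  assumes "compact_space Y" "Hausdorff_space Y"
  shows "uniformity_of Y = diagonal_neighbourhoods Y"
  unfolding uniformity_of_def
  using compatible_diagonal_neighbourhoods[OF assms] compatible_uniformity_unique[OF assms(1)]
  by (rule the_equality)

lemma flow_identity:
  assumes "flow Y act" "y \<in> topspace Y"
  shows "act 0 y = y"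
proof -
  have hom: "homeomorphic_map Y Y (act 0)" using assms(1) by (simp add: flow_def)
  have "act 0 y \<in> topspace Y" using hom assms(2) homeomorphic_imp_surjective_map by blast
  moreover have "act 0 (act 0 y) = act 0 y"
    using assms unfolding flow_def by (metis add_0)
  ultimately show ?thesis
    using homeomorphic_imp_injective_map[OF hom] assms(2) by (meson inj_onD)
qed

theorem flow_enveloping_semigroup:
  fixes act :: "'g::topological_group_add \<Rightarrow> 'a \<Rightarrow> 'a"
  assumes flow: "flow X act"
  shows "flow (enveloping_semigroup X act) (enveloping_action X act)"
proof -
  define P where "P = self_maps X"
  define R where "R = range (\<lambda>t. restrict (act t) (topspace X))"
  define E where "E = enveloping_semigroup X act"
  define L where "L = enveloping_action X act"
  have E: "E = subtopology P (P closure_of R)"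
    by (simp add: E_def P_def R_def enveloping_semigroup_def)
  have topE: "topspace E = P closure_of R"
    by (simp add: E closure_of_subset_topspace inf.absorb2)
  have topP: "topspace P = topspace X \<rightarrow>\<^sub>E topspace X" by (simp add: P_def self_maps_def)
  have cont: "continuous_map (prod_topology euclidean X) X (\<lambda>(t, y). act t y)"
    and assoc: "\<And>s t y. y \<in> topspace X \<Longrightarrow> act (s + t) y = act s (act t y)"
    and hom: "\<And>t. homeomorphic_map X X (act t)"
    and cpt: "compact_space X" and hd: "Hausdorff_space X"
    using flow by (simp_all add: flow_def)
  have act_top: "act t y \<in> topspace X" if "y \<in> topspace X" for t y
    using hom[of t] that homeomorphic_imp_surjective_map by blast
  have "compact_space P" "Hausdorff_space P"
    using cpt hd by (simp_all add: P_def self_maps_def compact_space_product_topology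
        Hausdorff_space_product_topology)
  then have E1: "compact_space E" "Hausdorff_space E"
    by (simp_all add: E Hausdorff_space_subtopology closedin_compact_space compact_space_subtopology)
  have RP: "R \<subseteq> topspace P" using act_top by (auto simp: R_def topP)
  have cont_P: "continuous_map (prod_topology euclidean P) P (\<lambda>(t, p). L t p)"
    unfolding P_def self_maps_def continuous_map_componentwise
  proof (intro conjI ballI)
    show "(\<lambda>(t, p). L t p) ` topspace (prod_topology euclidean (product_topology (\<lambda>_. X) (topspace X)))
        \<subseteq> extensional (topspace X)"
      by (auto simp: L_def enveloping_action_def)
    fix x assume x: "x \<in> topspace X"
    have "continuous_map (prod_topology euclidean (product_topology (\<lambda>_. X) (topspace X)))
        (prod_topology (euclidean :: 'g topology) X) (\<lambda>z. (fst z, snd z x))"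
      using x by (intro continuous_map_pairedI continuous_map_fst
          continuous_map_compose[OF continuous_map_snd continuous_map_product_projection,
            unfolded o_def])
    from continuous_map_compose[OF this cont]
    show "continuous_map (prod_topology euclidean (product_topology (\<lambda>_. X) (topspace X))) X
        (\<lambda>z. (case z of (t, p) \<Rightarrow> L t p) x)"
      using x by (simp add: o_def case_prod_unfold L_def enveloping_action_def compose_def)
  qed
  have L_P: "continuous_map P P (L t)" for t
  proof -
    have "continuous_map P (prod_topology euclidean P) (\<lambda>p. (t, p))"
      by (intro continuous_map_pairedI) auto
    from continuous_map_compose[OF this cont_P] show ?thesis by (simp add: o_def)
  qed
  have L_R: "L t ` R \<subseteq> R" for t
  proof
    fix q assume "q \<in> L t ` R"
    then obtain s where "q = compose (topspace X) (act t) (restrict (act s) (topspace X))"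
      by (auto simp: R_def L_def enveloping_action_def)
    then have "q = restrict (act (t + s)) (topspace X)"
      by (auto simp: compose_def fun_eq_iff assoc)
    then show "q \<in> R" by (simp add: R_def)
  qed
  have L_E: "L t p \<in> topspace E" if "p \<in> topspace E" for t p
  proof -
    have "L t ` (P closure_of R) \<subseteq> P closure_of (L t ` R)"
      by (rule continuous_map_image_closure_subset[OF L_P])
    then show ?thesis using that closure_of_mono[OF L_R] unfolding topE by blast
  qed
  have cont_E: "continuous_map (prod_topology euclidean E) E (\<lambda>(t, p). L t p)"
  proof -
    have "continuous_map (prod_topology euclidean E) (prod_topology (euclidean :: 'g topology) P) id"
      unfolding E using continuous_map_from_subtopology[OF continuous_map_id]
      by (metis continuous_map_id_subt prod_topology_subtopology(2))
    from continuous_map_compose[OF this cont_P]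
    have "continuous_map (prod_topology euclidean E) P (\<lambda>(t, p). L t p)" by simp
    then show ?thesis
      using L_E unfolding E continuous_map_in_subtopology
      by (auto simp: topE[unfolded E] topE[symmetric])
  qed
  have "topspace E \<subseteq> topspace P" unfolding topE by (rule closure_of_subset_topspace)
  then have E_fun: "p \<in> topspace E \<Longrightarrow> x \<in> topspace X \<Longrightarrow> p x \<in> topspace X"
    and E_ext: "p \<in> topspace E \<Longrightarrow> p \<in> extensional (topspace X)" for p x
    by (auto simp: topP PiE_iff subset_iff)
  have L_assoc: "L (s + t) p = L s (L t p)" if "p \<in> topspace E" for s t p
    using E_fun that by (auto simp: L_def enveloping_action_def compose_def fun_eq_iff assoc)
  have L_0: "L 0 p = p" if "p \<in> topspace E" for p
    by (rule extensionalityI[of _ "topspace X"])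
      (use E_fun E_ext that flow_identity[OF flow] in
        \<open>auto simp: L_def enveloping_action_def compose_def\<close>)
  have L_cont: "continuous_map E E (L t)" for t
  proof -
    have "continuous_map E (prod_topology euclidean E) (\<lambda>p. (t, p))"
      by (intro continuous_map_pairedI) auto
    from continuous_map_compose[OF this cont_E] show ?thesis by (simp add: o_def)
  qed
  have "homeomorphic_maps E E (L t) (L (- t))" for t
    unfolding homeomorphic_maps_def using L_cont L_assoc[symmetric] L_0 by simp
  then have "homeomorphic_map E E (L t)" for t
    using homeomorphic_maps_map by blast
  then show ?thesis
    using E1 cont_E L_assoc unfolding flow_def E_def[symmetric] L_def[symmetric] by blast
qed

end

theory Submission
  imports Defs
begin

text \<open>
  An entourage of \<open>E(X)\<close> only restricts finitely many coordinates, each up to an entourage of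
  \<open>X\<close>. Since every \<open>p \<in> E(X)\<close> takes values in \<open>X\<close>, the pairs \<open>(t p x, p x)\<close> are controlled by
  uniform convergence on \<open>X\<close>. Conversely, if the orbit of \<open>y\<close> is dense, then \<open>p \<mapsto> p y\<close> maps
  \<open>E(X)\<close> continuously and equivariantly onto \<open>X\<close>, and uniform convergence to the identity passes to
  factors.
\<close>

section \<open>Operations on neighbourhoods of the diagonal\<close>

lemma diagonal_neighbourhoods_Inter:
  assumes "finite A" and "\<And>i. i \<in> A \<Longrightarrow> V i \<in> diagonal_neighbourhoods Y"
  shows "topspace Y \<times> topspace Y \<inter> (\<Inter>i\<in>A. V i) \<in> diagonal_neighbourhoods Y"
  unfolding diagonal_neighbourhoods_def mem_Collect_eq
proof (intro conjI ballI)
  fix y assume y: "y \<in> topspace Y"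
  have "\<exists>N. openin Y N \<and> y \<in> N \<and> N \<times> N \<subseteq> V i" if "i \<in> A" for i
    using assms(2)[OF that] y unfolding diagonal_neighbourhoods_def by blast
  then obtain N where N: "\<And>i. i \<in> A \<Longrightarrow> openin Y (N i) \<and> y \<in> N i \<and> N i \<times> N i \<subseteq> V i"
    by metis
  \<comment> \<open>The factor \<open>topspace Y\<close> keeps \<open>M\<close> an open subset of
    the space even when \<open>A\<close> is empty and the indexed intersection is the whole
    type.\<close>
  define M where "M = topspace Y \<inter> (\<Inter>i\<in>A. N i)"
  have "openin Y M"
    unfolding M_def by (subst Int_commute, rule openin_INT) (use assms(1) N in auto)
  moreover have "y \<in> M" using y N by (auto simp: M_def)
  moreover have "M \<times> M \<subseteq> topspace Y \<times> topspace Y \<inter> (\<Inter>i\<in>A. V i)"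
    using N by (fastforce simp: M_def)
  ultimately show "\<exists>M. openin Y M \<and> y \<in> M \<and>
      M \<times> M \<subseteq> topspace Y \<times> topspace Y \<inter> (\<Inter>i\<in>A. V i)" by blast
qed blast

text \<open>For compact Hausdorff spaces this is uniform continuity of \<open>f\<close>: the
  preimage of a small open \<open>N\<close> has its square inside the pulled-back entourage.\<close>

lemma diagonal_neighbourhoods_vimage:
  assumes "continuous_map Y Z f" and "V \<in> diagonal_neighbourhoods Z"
  shows "{(p, q) \<in> topspace Y \<times> topspace Y. (f p, f q) \<in> V} \<in> diagonal_neighbourhoods Y"
  unfolding diagonal_neighbourhoods_def mem_Collect_eq
proof (intro conjI ballI)
  fix p assume p: "p \<in> topspace Y"
  then have "f p \<in> topspace Z" using assms(1) continuous_map_image_subset_topspace by blast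
  then obtain N where N: "openin Z N" "f p \<in> N" "N \<times> N \<subseteq> V"
    using assms(2) unfolding diagonal_neighbourhoods_def by blast
  have "openin Y {q \<in> topspace Y. f q \<in> N}"
    using assms(1) N(1) by (rule openin_continuous_map_preimage)
  then show "\<exists>M. openin Y M \<and> p \<in> M \<and>
      M \<times> M \<subseteq> {(p, q) \<in> topspace Y \<times> topspace Y. (f p, f q) \<in> V}"
    using p N by (intro exI[of _ "{q \<in> topspace Y. f q \<in> N}"]) auto
qed auto

text \<open>Provides the room for a triangle inequality: two successive \<open>V\<close>-steps from
  \<open>y\<close> still end in \<open>A\<close>. The first step will lead from a centre to a nearby
  point, the second from there to a third point.\<close>

lemma diagonal_neighbourhoods_half_Image:
  assumes "compact_space Y" "Hausdorff_space Y" "openin Y A" "y \<in> A"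
  shows "\<exists>V\<in>diagonal_neighbourhoods Y. (V O V) `` {y} \<subseteq> A"
proof -
  obtain U where U: "U \<in> diagonal_neighbourhoods Y" "U `` {y} \<subseteq> A"
    using compatible_diagonal_neighbourhoods[OF assms(1,2)] assms(3,4)
    unfolding compatible_uniformity_def by blast
  obtain V where V: "V \<in> diagonal_neighbourhoods Y" "V O V \<subseteq> U"
    using diagonal_neighbourhoods_half[OF assms(1,2) U(1)] by blast
  then have "(V O V) `` {y} \<subseteq> A" using U(2) by blast
  then show ?thesis using V(1) by blast
qed

section \<open>The uniformity of a compact subspace of a product\<close>

text \<open>A Lebesgue number argument: near each point \<open>U\<close> contains the square of a
  basic box, which constrains finitely many coordinates; halved entourages leave room to move away
  from the centre of the box; compactness of \<open>Y\<close> leaves finitely many centres.\<close>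

lemma diagonal_neighbourhoods_product:
  fixes X :: "'i \<Rightarrow> 'a topology"
  assumes cpt: "\<And>i. i \<in> I \<Longrightarrow> compact_space (X i)" and hd: "\<And>i. i \<in> I \<Longrightarrow> Hausdorff_space (X i)"
    and Y: "Y = subtopology (product_topology X I) S" and cptY: "compact_space Y"
    and U: "U \<in> diagonal_neighbourhoods Y"
  obtains F V where "finite F" "F \<subseteq> I" "\<And>i. i \<in> F \<Longrightarrow> V i \<in> diagonal_neighbourhoods (X i)"
    "\<And>p q. p \<in> topspace Y \<Longrightarrow> q \<in> topspace Y \<Longrightarrow> (\<And>i. i \<in> F \<Longrightarrow> (p i, q i) \<in> V i) \<Longrightarrow> (p, q) \<in> U"
proof -
  have topY: "topspace Y = (\<Pi>\<^sub>E i\<in>I. topspace (X i)) \<inter> S" by (simp add: Y)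
  \<comment> \<open>Local form at a centre \<open>p\<close>: points of \<open>N\<close> are one
    \<open>V\<close>-step away from \<open>p\<close> in the coordinates \<open>F\<close>, and a
    second step from \<open>q\<close> to \<open>r\<close> keeps both \<open>q\<close> and
    \<open>r\<close> in the box around \<open>p\<close>.\<close>
  have "\<exists>F V N. finite F \<and> F \<subseteq> I \<and> (\<forall>i\<in>I. V i \<in> diagonal_neighbourhoods (X i)) \<and>
      openin Y N \<and> p \<in> N \<and> (\<forall>q\<in>N. \<forall>i\<in>F. (p i, q i) \<in> V i) \<and>
      (\<forall>q\<in>topspace Y. \<forall>r\<in>topspace Y.
        (\<forall>i\<in>F. (p i, q i) \<in> V i \<and> (q i, r i) \<in> V i) \<longrightarrow> (q, r) \<in> U)"
    if p: "p \<in> topspace Y" for p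
  proof -
    obtain M where M: "openin Y M" "p \<in> M" "M \<times> M \<subseteq> U"
      using U p unfolding diagonal_neighbourhoods_def by blast
    then obtain M' where M': "openin (product_topology X I) M'" "M = M' \<inter> S"
      unfolding Y openin_subtopology by blast
    then have "p \<in> M'" using M(2) by blast
    from M'(1)[unfolded openin_product_topology_alt, rule_format, OF this]
    obtain B where fin: "finite {i \<in> I. B i \<noteq> topspace (X i)}"
      and B: "\<And>i. i \<in> I \<Longrightarrow> openin (X i) (B i)" "p \<in> Pi\<^sub>E I B" "Pi\<^sub>E I B \<subseteq> M'"
      by blast
    \<comment> \<open>Only these coordinates are constrained by the box; in all others membership in
      \<open>B i\<close> is automatic for points of \<open>Y\<close>.\<close>
    define F where "F = {i \<in> I. B i \<noteq> topspace (X i)}"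
    have finF: "finite F" and FI: "F \<subseteq> I" using fin by (auto simp: F_def)
    have "\<exists>V\<in>diagonal_neighbourhoods (X i). (V O V) `` {p i} \<subseteq> B i" if "i \<in> I" for i
      using diagonal_neighbourhoods_half_Image[OF cpt hd B(1)] B(2) that by (auto simp: PiE_iff)
    then obtain V where V: "\<And>i. i \<in> I \<Longrightarrow> V i \<in> diagonal_neighbourhoods (X i)"
      "\<And>i. i \<in> I \<Longrightarrow> (V i O V i) `` {p i} \<subseteq> B i" by metis
    have pi: "p i \<in> topspace (X i)" if "i \<in> I" for i using p that by (auto simp: topY)
    \<comment> \<open>The section of \<open>V i\<close> at \<open>p i\<close> need not be open, so
      an open \<open>A i\<close> inside it is used to make \<open>N\<close> open.\<close>
    have "\<exists>A. openin (X i) A \<and> p i \<in> A \<and> A \<subseteq> V i `` {p i}" if "i \<in> I" for i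
      using compatible_uniformity_neighbourhood
        [OF compatible_diagonal_neighbourhoods[OF cpt hd] V(1) pi] that by blast
    then obtain A where A: "\<And>i. i \<in> I \<Longrightarrow> openin (X i) (A i) \<and> p i \<in> A i \<and> A i \<subseteq> V i `` {p i}"
      by metis
    define N where "N = topspace Y \<inter> (\<Inter>i\<in>F. {q \<in> topspace Y. q i \<in> A i})"
    have "openin Y {q \<in> topspace Y. q i \<in> A i}" if "i \<in> F" for i
    proof (rule openin_continuous_map_preimage)
      show "continuous_map Y (X i) (\<lambda>q. q i)"
        unfolding Y using that FI
        by (intro continuous_map_from_subtopology continuous_map_product_projection) blast
    qed (use A that FI in blast)
    then have "openin Y N"
      unfolding N_def by (subst Int_commute, intro openin_INT) (use finF in auto)
    moreover have "p \<in> N" using p A by (auto simp: N_def F_def)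
    moreover have "\<forall>q\<in>N. \<forall>i\<in>F. (p i, q i) \<in> V i" using A by (fastforce simp: N_def F_def)
    moreover have qrU: "(q, r) \<in> U"
      if q: "q \<in> topspace Y" and r: "r \<in> topspace Y"
        and qr: "\<forall>i\<in>F. (p i, q i) \<in> V i \<and> (q i, r i) \<in> V i" for q r
    proof -
      have "q i \<in> B i \<and> r i \<in> B i" if "i \<in> I" for i
      proof (cases "i \<in> F")
        case True
        then have *: "(p i, q i) \<in> V i" "(q i, r i) \<in> V i" using qr by auto
        \<comment> \<open>The loop at \<open>q i\<close> serves as the second step, so that
          \<open>q i\<close> itself, and not only \<open>r i\<close>, lies in the image of
          \<open>p i\<close> under \<open>V i O V i\<close>.\<close>
        then have "q i \<in> topspace (X i)" "(q i, q i) \<in> V i"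
          using V(1)[OF that] unfolding diagonal_neighbourhoods_def by blast+
        then show ?thesis using V(2)[OF that] * by blast
      next
        case False
        then show ?thesis using q r that by (auto simp: F_def topY)
      qed
      then have "q \<in> Pi\<^sub>E I B" "r \<in> Pi\<^sub>E I B" using q r by (auto simp: topY PiE_iff)
      then show ?thesis using B(3) M(3) M'(2) q r by (auto simp: topY)
    qed
    ultimately show ?thesis
      using V(1) finF FI by (intro exI[of _ F] exI[of _ V] exI[of _ N] conjI ballI impI qrU) auto
  qed
  then obtain F V N where FVN: "\<And>p. p \<in> topspace Y \<Longrightarrow> finite (F p) \<and> F p \<subseteq> I \<and>
      (\<forall>i\<in>I. V p i \<in> diagonal_neighbourhoods (X i)) \<and>
      openin Y (N p) \<and> p \<in> N p \<and> (\<forall>q\<in>N p. \<forall>i\<in>F p. (p i, q i) \<in> V p i) \<and>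
      (\<forall>q\<in>topspace Y. \<forall>r\<in>topspace Y.
        (\<forall>i\<in>F p. (p i, q i) \<in> V p i \<and> (q i, r i) \<in> V p i) \<longrightarrow> (q, r) \<in> U)"
    by metis
  obtain G where G: "finite G" "G \<subseteq> topspace Y" "topspace Y \<subseteq> (\<Union>p\<in>G. N p)"
    using compact_space_point_cover[of Y N, OF cptY] FVN by auto
  \<comment> \<open>Intersecting over all centres makes the entourage independent of the centre.
    This is legitimate because \<open>V p i\<close> is an entourage for every
    \<open>i \<in> I\<close>, also outside \<open>F p\<close>.\<close>
  define W where "W i = topspace (X i) \<times> topspace (X i) \<inter> (\<Inter>p\<in>G. V p i)" for i
  show ?thesis
  proof (rule that[of "\<Union>p\<in>G. F p" W])
    have *: "finite (F p)" "F p \<subseteq> I" if "p \<in> G" for p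
      using FVN[OF subsetD[OF G(2) that]] by simp_all
    show "finite (\<Union>p\<in>G. F p)" using G(1) * by simp
    show FI: "(\<Union>p\<in>G. F p) \<subseteq> I" using * by blast
    show "W i \<in> diagonal_neighbourhoods (X i)" if i: "i \<in> (\<Union>p\<in>G. F p)" for i
      unfolding W_def
    proof (rule diagonal_neighbourhoods_Inter[OF G(1)])
      fix p assume "p \<in> G"
      then have "p \<in> topspace Y" using G(2) by blast
      moreover have "i \<in> I" using FI i by blast
      ultimately show "V p i \<in> diagonal_neighbourhoods (X i)" using FVN by simp
    qed
    fix q r assume q: "q \<in> topspace Y" and r: "r \<in> topspace Y"
      and qr: "\<And>i. i \<in> (\<Union>p\<in>G. F p) \<Longrightarrow> (q i, r i) \<in> W i"
    \<comment> \<open>The centre is chosen for \<open>q\<close> alone; \<open>r\<close> is reached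
      by the second step through \<open>W\<close>.\<close>
    obtain p where p: "p \<in> G" "q \<in> N p" using G(3) q by blast
    then have pY: "p \<in> topspace Y" using G(2) by blast
    have "(p i, q i) \<in> V p i \<and> (q i, r i) \<in> V p i" if "i \<in> F p" for i
    proof
      show "(p i, q i) \<in> V p i" using FVN[OF pY] p(2) that by simp
      have "(q i, r i) \<in> W i" using qr p(1) that by blast
      then show "(q i, r i) \<in> V p i" using p(1) by (auto simp: W_def)
    qed
    then show "(q, r) \<in> U" using FVN[OF pY] q r by simp
  qed
qed

section \<open>Transfer of uniform convergence along a net\<close>

text \<open>An entourage of \<open>Z\<close> pulls back along \<open>f\<close> to one of
  \<open>Y\<close>; surjectivity writes each \<open>z\<close> as \<open>f y\<close>, and
  equivariance carries the estimate at \<open>y\<close> to \<open>z\<close>.\<close>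

lemma converges_uniformly_to_id_factor:
  assumes Y: "compact_space Y" "Hausdorff_space Y" and Z: "compact_space Z" "Hausdorff_space Z"
    and f: "continuous_map Y Z f" "f ` topspace Y = topspace Z"
    and equiv: "\<And>t y. y \<in> topspace Y \<Longrightarrow> f (act t y) = act' t (f y)"
    and conv: "converges_uniformly_to_id Y act D le t"
  shows "converges_uniformly_to_id Z act' D le t"
  unfolding converges_uniformly_to_id_def uniformity_of_eq[OF Z]
proof
  fix V assume V: "V \<in> diagonal_neighbourhoods Z"
  define U where "U = {(p, q) \<in> topspace Y \<times> topspace Y. (f p, f q) \<in> V}"
  have "U \<in> diagonal_neighbourhoods Y"
    unfolding U_def by (rule diagonal_neighbourhoods_vimage[OF f(1) V])
  then obtain i where i: "i \<in> D"
    and *: "\<And>j y. j \<in> D \<Longrightarrow> le i j \<Longrightarrow> y \<in> topspace Y \<Longrightarrow> (act (t j) y, y) \<in> U"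
    using conv unfolding converges_uniformly_to_id_def uniformity_of_eq[OF Y] by blast
  have "(act' (t j) z, z) \<in> V" if j: "j \<in> D" "le i j" and z: "z \<in> topspace Z" for j z
  proof -
    obtain y where "y \<in> topspace Y" "z = f y" using f(2) z by blast
    then show ?thesis using *[OF j] equiv by (auto simp: U_def)
  qed
  then show "\<exists>i\<in>D. \<forall>j\<in>D. le i j \<longrightarrow> (\<forall>z\<in>topspace Z. (act' (t j) z, z) \<in> V)"
    using i by blast
qed

lemma flow_act_in_topspace:
  assumes "flow Y act" "y \<in> topspace Y"
  shows "act t y \<in> topspace Y"
proof -
  have "act t ` topspace Y = topspace Y"
    using assms(1) by (simp add: flow_def homeomorphic_imp_surjective_map)
  then show ?thesis using assms(2) by blast
qed

lemma enveloping_semigroup_in_topspace: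
  assumes "p \<in> topspace (enveloping_semigroup X act)" "x \<in> topspace X"
  shows "p x \<in> topspace X"
  using assms by (auto simp: enveloping_semigroup_def self_maps_def)

text \<open>Uniformity over \<open>X\<close> is what makes this work: even at a fixed coordinate
  \<open>x\<close>, the values \<open>p x\<close> vary with \<open>p\<close>, and all of them must
  be moved little by the same \<open>t j\<close>.\<close>

lemma converges_uniformly_to_id_enveloping:
  assumes flow: "flow X act" and conv: "converges_uniformly_to_id X act D le t"
  shows "converges_uniformly_to_id (enveloping_semigroup X act) (enveloping_action X act) D le t"
proof -
  define E where "E = enveloping_semigroup X act"
  have X: "compact_space X" "Hausdorff_space X" using flow by (simp_all add: flow_def)
  have flow_E: "flow E (enveloping_action X act)"
    unfolding E_def by (rule flow_enveloping_semigroup[OF flow])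
  then have E: "compact_space E" "Hausdorff_space E" by (simp_all add: flow_def)
  have "\<exists>i\<in>D. \<forall>j\<in>D. le i j \<longrightarrow> (\<forall>p\<in>topspace E. (enveloping_action X act (t j) p, p) \<in> U)"
    if U: "U \<in> diagonal_neighbourhoods E" for U
  proof -
    obtain F V where F: "finite F" "F \<subseteq> topspace X"
      and V: "\<And>x. x \<in> F \<Longrightarrow> V x \<in> diagonal_neighbourhoods X"
      and FV: "\<And>p q. p \<in> topspace E \<Longrightarrow> q \<in> topspace E \<Longrightarrow>
        (\<And>x. x \<in> F \<Longrightarrow> (p x, q x) \<in> V x) \<Longrightarrow> (p, q) \<in> U"
      using diagonal_neighbourhoods_product[OF X
          E_def[unfolded enveloping_semigroup_def self_maps_def] E(1) U] by blast
    \<comment> \<open>One entourage for all coordinates in \<open>F\<close> gives a single index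
      \<open>i\<close> valid for all of them.\<close>
    define W where "W = topspace X \<times> topspace X \<inter> (\<Inter>x\<in>F. V x)"
    have "W \<in> uniformity_of X"
      unfolding W_def uniformity_of_eq[OF X] by (rule diagonal_neighbourhoods_Inter[OF F(1) V])
    then obtain i where i: "i \<in> D"
      and *: "\<And>j x. j \<in> D \<Longrightarrow> le i j \<Longrightarrow> x \<in> topspace X \<Longrightarrow> (act (t j) x, x) \<in> W"
      using conv unfolding converges_uniformly_to_id_def by blast
    have "(enveloping_action X act (t j) p, p) \<in> U"
      if j: "j \<in> D" "le i j" and p: "p \<in> topspace E" for j p
    proof (rule FV[OF flow_act_in_topspace[OF flow_E p] p])
      fix x assume x: "x \<in> F"
      then have "p x \<in> topspace X"
        using enveloping_semigroup_in_topspace[OF p[unfolded E_def]] F(2) by auto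
      then have "(act (t j) (p x), p x) \<in> V x" using *[OF j] x by (auto simp: W_def)
      then show "(enveloping_action X act (t j) p x, p x) \<in> V x"
        using x F(2) by (auto simp: enveloping_action_def compose_def)
    qed
    then show ?thesis using i by blast
  qed
  then show ?thesis
    unfolding converges_uniformly_to_id_def E_def[symmetric] uniformity_of_eq[OF E] by blast
qed

section \<open>Evaluation at a point with dense orbit\<close>

text \<open>The image of evaluation contains the orbit of \<open>y\<close>, since the restricted
  maps \<open>act t\<close> lie in the enveloping semigroup. It is compact, hence closed in the
  Hausdorff space \<open>X\<close>, so it contains the closure of the orbit.\<close>

lemma enveloping_semigroup_evaluation_surj:
  assumes flow: "flow X act" and y: "y \<in> topspace X"
    and dense: "X closure_of (range (\<lambda>t. act t y)) = topspace X"
  shows "continuous_map (enveloping_semigroup X act) X (\<lambda>p. p y)"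
    and "(\<lambda>p. p y) ` topspace (enveloping_semigroup X act) = topspace X"
proof -
  define E where "E = enveloping_semigroup X act"
  have X: "Hausdorff_space X" using flow by (simp add: flow_def)
  have E: "compact_space E"
    using flow_enveloping_semigroup[OF flow] by (simp add: E_def flow_def)
  show cont: "continuous_map (enveloping_semigroup X act) X (\<lambda>p. p y)"
    unfolding enveloping_semigroup_def self_maps_def
    by (intro continuous_map_from_subtopology continuous_map_product_projection y)
  have "range (\<lambda>t. restrict (act t) (topspace X)) \<subseteq> topspace (self_maps X)"
    using flow_act_in_topspace[OF flow] by (auto simp: self_maps_def)
  then have "range (\<lambda>t. restrict (act t) (topspace X)) \<subseteq> topspace E"
    by (simp add: E_def enveloping_semigroup_def closure_of_subset)
  then have "(\<lambda>p. p y) ` range (\<lambda>t. restrict (act t) (topspace X)) \<subseteq> (\<lambda>p. p y) ` topspace E"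
    by (rule image_mono)
  then have "range (\<lambda>t. act t y) \<subseteq> (\<lambda>p. p y) ` topspace E"
    using y by (simp add: image_image)
  moreover have "closedin X ((\<lambda>p. p y) ` topspace E)"
    using E X cont unfolding E_def
    by (meson compact_space_def compactin_imp_closedin image_compactin)
  ultimately have "topspace X \<subseteq> (\<lambda>p. p y) ` topspace E"
    unfolding dense[symmetric] by (rule closure_of_minimal)
  then show "(\<lambda>p. p y) ` topspace (enveloping_semigroup X act) = topspace X"
    using continuous_map_image_subset_topspace[OF cont] by (simp add: E_def subset_antisym)
qed

lemma converges_uniformly_to_id_of_enveloping:
  assumes flow: "flow X act" and trans: "point_transitive X act"
    and conv: "converges_uniformly_to_id
      (enveloping_semigroup X act) (enveloping_action X act) D le t"
  shows "converges_uniformly_to_id X act D le t"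
proof -
  have flow_E: "flow (enveloping_semigroup X act) (enveloping_action X act)"
    by (rule flow_enveloping_semigroup[OF flow])
  obtain y where y: "y \<in> topspace X" "X closure_of (range (\<lambda>t. act t y)) = topspace X"
    using trans unfolding point_transitive_def by blast
  show ?thesis
  proof (rule converges_uniformly_to_id_factor[OF _ _ _ _
        enveloping_semigroup_evaluation_surj[OF flow y] _ conv])
    \<comment> \<open>Equivariance of evaluation; \<open>y\<close> lies in
      \<open>topspace X\<close>, where \<open>compose\<close> does not take its default value
      \<open>undefined\<close>.\<close>
    show "enveloping_action X act s p y = act s (p y)" for s p
      using y(1) by (simp add: enveloping_action_def compose_def)
  qed (use flow flow_E in \<open>auto simp: flow_def\<close>)
qed

text \<open>The last conjunct sharpens the existence statements: the very same net serves both
  flows, over any index type. Hence further conditions on the net in the group, such as avoiding the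
  identity, carry over as well.\<close>

theorem theorem12:
  fixes X :: "'a topology"
    and act :: "'g::topological_group_add \<Rightarrow> 'a \<Rightarrow> 'a"
  assumes "flow X act"
    and "no_isolated_points X"
  shows "(uniformly_rigid X act \<longrightarrow>
            uniformly_rigid (enveloping_semigroup X act) (enveloping_action X act)) \<and>
         (point_transitive X act \<longrightarrow>
            uniformly_rigid (enveloping_semigroup X act) (enveloping_action X act) \<longrightarrow>
            uniformly_rigid X act) \<and>
         (\<forall>(D :: 'i set) le t. directed_set D le \<longrightarrow>
            (converges_uniformly_to_id X act D le t \<longrightarrow>
               converges_uniformly_to_id
                 (enveloping_semigroup X act) (enveloping_action X act) D le t) \<and>
            (point_transitive X act \<longrightarrow>
               converges_uniformly_to_id
                 (enveloping_semigroup X act) (enveloping_action X act) D le t \<longrightarrow>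
               converges_uniformly_to_id X act D le t))"
proof (intro conjI allI impI)
  \<comment> \<open>Both flows have the same acting group, so \<open>uniformly_rigid\<close> ranges
    over the same nets for both and the witness can be reused unchanged.\<close>
  show "uniformly_rigid (enveloping_semigroup X act) (enveloping_action X act)"
    if "uniformly_rigid X act"
    using that converges_uniformly_to_id_enveloping[OF assms(1)]
    unfolding uniformly_rigid_def by blast
  show "uniformly_rigid X act"
    if "point_transitive X act"
      "uniformly_rigid (enveloping_semigroup X act) (enveloping_action X act)"
    using that(2) converges_uniformly_to_id_of_enveloping[OF assms(1) that(1)]
    unfolding uniformly_rigid_def by blast
  show "converges_uniformly_to_id
      (enveloping_semigroup X act) (enveloping_action X act) D le t"
    if "converges_uniformly_to_id X act D le t" for D :: "'i set" and le t
    using assms(1) that by (rule converges_uniformly_to_id_enveloping)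
  show "converges_uniformly_to_id X act D le t"
    if "point_transitive X act" "converges_uniformly_to_id
      (enveloping_semigroup X act) (enveloping_action X act) D le t" for D :: "'i set" and le t
    using assms(1) that by (rule converges_uniformly_to_id_of_enveloping)
qed

end
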